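(* Let $p,m\ge 1$. To a gapless rectangular shape $r=(r_{i,j})_{1\le i\le p,\,1\le j\le m}$ associate its cumulant array $s_{i,j}=\sum_{k=i}^p r_{k,j}$ and the triangular array $t=(t_{i,j})_{1\le i\le p,\ 1\le j\le p+1-i}$, where $t_{i,j}$ is the smallest $k\in\{1,\dots,m\}$ such that $s_{p+2-i-j,\,k}\ge j$ if such a $k$ exists, and $t_{i,j}=m+1$ otherwise. Then $r\mapsto t$ is a bijection between the gapless rectangular shapes with $p$ rows and $m$ columns and the $p$-branchings with entries less than or equal to $m+1$.
   Context: A gapless rectangular shape with $p$ rows and $m$ columns is a rectangular array $(r_{i,j})_{1\le i\le p,\,1\le j\le m}$ of 0's and 1's such that for all $1\le j<m$ and $1\le i\le p$, $\sum_{k=i}^p r_{k,j}\le\sum_{k=i}^p r_{k,j+1}$. A $p$-branching is a triangular array of positive integers $b_{i,j}$, $1\le i\le p$, $1\le j\le p+1-i$, with $b_{i+1,j}\le b_{i,j}\le b_{i,j+1}$ whenever the entries are defined. *)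

theory Defs
  imports Main "HOL-Library.FuncSet"
begin

text \<open>
  Arrays are functions on pairs (row, column), counted from 1. They are extensional on their
  index set, so that two arrays are equal iff their entries are.
\<close>

definition cumulant :: "nat \<Rightarrow> (nat \<times> nat \<Rightarrow> nat) \<Rightarrow> nat \<Rightarrow> nat \<Rightarrow> nat" where
  "cumulant p r i j = (\<Sum>k = i..p. r (k, j))"

definition gapless_shapes :: "nat \<Rightarrow> nat \<Rightarrow> (nat \<times> nat \<Rightarrow> nat) set" where
  "gapless_shapes p m =
    {r \<in> {1..p} \<times> {1..m} \<rightarrow>\<^sub>E {0, 1}.
      \<forall>i j. 1 \<le> i \<and> i \<le> p \<and> 1 \<le> j \<and> j < m \<longrightarrow>
        (\<Sum>k = i..p. r (k, j)) \<le> (\<Sum>k = i..p. r (k, j + 1))}"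

definition triangle :: "nat \<Rightarrow> (nat \<times> nat) set" where
  "triangle p = {(i, j). 1 \<le> i \<and> i \<le> p \<and> 1 \<le> j \<and> j \<le> p + 1 - i}"

definition branchings :: "nat \<Rightarrow> (nat \<times> nat \<Rightarrow> nat) set" where
  "branchings p =
    {b \<in> triangle p \<rightarrow>\<^sub>E {1..}.
      (\<forall>i j. (i, j) \<in> triangle p \<and> (i + 1, j) \<in> triangle p \<longrightarrow> b (i + 1, j) \<le> b (i, j)) \<and>
      (\<forall>i j. (i, j) \<in> triangle p \<and> (i, j + 1) \<in> triangle p \<longrightarrow> b (i, j) \<le> b (i, j + 1))}"

definition branching_of_shape ::
  "nat \<Rightarrow> nat \<Rightarrow> (nat \<times> nat \<Rightarrow> nat) \<Rightarrow> nat \<times> nat \<Rightarrow> nat" where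
  "branching_of_shape p m r =
    (\<lambda>(i, j) \<in> triangle p.
      if \<exists>k\<in>{1..m}. cumulant p r (p + 2 - i - j) k \<ge> j
      then LEAST k. k \<in> {1..m} \<and> cumulant p r (p + 2 - i - j) k \<ge> j
      else m + 1)"

end

theory Submission imports Defs begin

text \<open>
  Both kinds of arrays encode the same family of Boolean conditions. Write \<open>s(a, k)\<close> for the
  cumulants and \<open>t(i, j)\<close> for the triangular array. In a gapless shape, row \<open>a\<close> of the cumulants is
  weakly increasing, so it is known from its thresholds: the first column at which it reaches \<open>j\<close>,
  for \<open>1 \<le> j \<le> p + 1 - a\<close>. These thresholds form the antidiagonal \<open>i + j = p + 2 - a\<close> of \<open>t\<close>, and
  for \<open>1 \<le> k \<le> m\<close> they satisfy the Galois-type equivalence (\<open>branching_of_shape_le_iff\<close>)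

  \<open>t(p + 2 - a - j, j) \<le> k \<longleftrightarrow> j \<le> s(a, k)\<close>.

  Under it, the condition that the shape has entries 0 and 1, that is
  \<open>s(a + 1, k) \<le> s(a, k) \<le> s(a + 1, k) + 1\<close>, becomes interlacing of consecutive antidiagonals: the
  first inequality turns into \<open>t(i + 1, j) \<le> t(i, j)\<close> and the second into \<open>t(i, j) \<le> t(i, j + 1)\<close>.
  These are the branching inequalities (\<open>branching_of_shape_in_branchings\<close>).

  The inverse map counts: \<open>s(a, k)\<close> is the number of entries at most \<open>k\<close> on the antidiagonal of row
  \<open>a\<close>. Interlacing makes each antidiagonal weakly increasing in \<open>j\<close>, so that the count satisfies the
  equivalence above (\<open>le_antidiagonal_count_iff\<close>), and the differences of counts for consecutive
  rows are the entries of the shape.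
\<close>

section \<open>Cumulants and thresholds of a gapless shape\<close>

lemma gapless_entry_le_1:
  assumes "r \<in> gapless_shapes p m" "i \<in> {1..p}" "k \<in> {1..m}"
  shows "r (i, k) \<le> 1"
proof -
  have "r (i, k) \<in> {0, 1}"
    using assms unfolding gapless_shapes_def by (blast dest: PiE_mem)
  then show ?thesis by auto
qed

lemma cumulant_unfold:
  "a \<le> p \<Longrightarrow> cumulant p r a k = r (a, k) + cumulant p r (a + 1) k"
  by (simp add: cumulant_def sum.atLeast_Suc_atMost)

lemma cumulant_le:
  assumes "r \<in> gapless_shapes p m" "a \<ge> 1" "k \<in> {1..m}"
  shows "cumulant p r a k \<le> p + 1 - a"
proof -
  have "cumulant p r a k \<le> of_nat (card {a..p}) * 1"
    unfolding cumulant_def using assms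
    by (intro sum_bounded_above gapless_entry_le_1) auto
  then show ?thesis by simp
qed

lemma cumulant_mono:
  assumes "r \<in> gapless_shapes p m" "a \<in> {1..p}" "1 \<le> k" "k \<le> l" "l \<le> m"
  shows "cumulant p r a k \<le> cumulant p r a l"
  using assms(4,5)
proof (induction l rule: dec_induct)
  case base
  then show ?case by simp
next
  case (step l)
  have "cumulant p r a l \<le> cumulant p r a (l + 1)"
    using assms(1-3) step unfolding gapless_shapes_def cumulant_def by auto
  then show ?case using step by simp
qed

lemma antidiagonal_in_triangle:
  assumes "a \<ge> 1" "j \<ge> 1" "a + j \<le> p + 1"
  shows "(p + 2 - a - j, j) \<in> triangle p"
  using assms by (auto simp: triangle_def)

lemma branching_of_shape_bounds:
  assumes "(i, j) \<in> triangle p"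
  shows "branching_of_shape p m r (i, j) \<in> {1..m + 1}"
proof (cases "\<exists>k\<in>{1..m}. cumulant p r (p + 2 - i - j) k \<ge> j")
  case True
  then have "\<exists>k. k \<in> {1..m} \<and> cumulant p r (p + 2 - i - j) k \<ge> j" by blast
  then have "(LEAST k. k \<in> {1..m} \<and> cumulant p r (p + 2 - i - j) k \<ge> j) \<in> {1..m}"
    by (rule LeastI2_ex) blast
  then show ?thesis using True assms by (simp add: branching_of_shape_def)
next
  case False
  then show ?thesis using assms by (simp add: branching_of_shape_def)
qed

text \<open>
  Monotonicity of the cumulant along a row makes the set of columns where it is at least \<open>j\<close> an
  upper set, so the least such column determines the whole set. The default value \<open>m + 1\<close> fits in,
  since it exceeds every column \<open>k\<close> considered.
\<close>

lemma branching_of_shape_le_iff: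
  assumes r: "r \<in> gapless_shapes p m" and ij: "(i, j) \<in> triangle p" and k: "k \<in> {1..m}"
  shows "branching_of_shape p m r (i, j) \<le> k \<longleftrightarrow> j \<le> cumulant p r (p + 2 - i - j) k"
proof -
  define P where "P k \<longleftrightarrow> k \<in> {1..m} \<and> j \<le> cumulant p r (p + 2 - i - j) k" for k
  have t: "branching_of_shape p m r (i, j) = (if \<exists>k. P k then Least P else m + 1)"
    using ij by (auto simp: branching_of_shape_def P_def [abs_def])
  have a: "p + 2 - i - j \<in> {1..p}"
    using ij by (auto simp: triangle_def)
  have upper: "P k" if "P l" "l \<le> k" for l
    using cumulant_mono[OF r a, of l k] that k by (auto simp: P_def)
  have "branching_of_shape p m r (i, j) \<le> k \<longleftrightarrow> P k"
  proof
    assume le: "branching_of_shape p m r (i, j) \<le> k"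
    then have ex: "\<exists>k. P k" using t k by (auto split: if_splits)
    then have "P (Least P)" by (rule LeastI_ex)
    then show "P k" using upper le t ex by auto
  next
    assume "P k"
    then show "branching_of_shape p m r (i, j) \<le> k" using t by (auto intro: Least_le)
  qed
  then show ?thesis using k by (simp add: P_def)
qed

lemma branching_of_shape_antidiagonal_le_iff:
  assumes "r \<in> gapless_shapes p m" "k \<in> {1..m}" "a \<ge> 1" "j \<ge> 1" "a + j \<le> p + 1"
  shows "branching_of_shape p m r (p + 2 - a - j, j) \<le> k \<longleftrightarrow> j \<le> cumulant p r a k"
  using branching_of_shape_le_iff[OF assms(1) antidiagonal_in_triangle[OF assms(3-5)] assms(2)] assms
  by simp

text \<open>
  Lets the equivalence, which speaks of columns \<open>k \<le> m\<close> only, yield inequalities between entries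
  of \<open>t\<close>: either \<open>y\<close> itself is a column to test with, or \<open>y \<ge> m + 1 \<ge> x\<close>.
\<close>

lemma le_by_columns:
  fixes x y m :: nat
  assumes "x \<le> m + 1" "y \<ge> 1" "\<And>k. k \<in> {1..m} \<Longrightarrow> y \<le> k \<Longrightarrow> x \<le> k"
  shows "x \<le> y"
  using assms(1,2) assms(3)[of y] by (cases "y \<le> m") auto

text \<open>
  The step down a column of \<open>t\<close> uses that entries of the shape are at least 0, the step along a row
  that they are at most 1.
\<close>

lemma branching_of_shape_in_branchings:
  assumes r: "r \<in> gapless_shapes p m"
  shows "branching_of_shape p m r \<in> branchings p"
proof -
  let ?t = "branching_of_shape p m r"
  have bounds: "?t (i, j) \<le> m + 1 \<and> 1 \<le> ?t (i, j)" if "(i, j) \<in> triangle p" for i j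
    using branching_of_shape_bounds[OF that, of m r] by simp
  have "?t (i + 1, j) \<le> ?t (i, j)"
    if ij: "(i, j) \<in> triangle p" and ij': "(i + 1, j) \<in> triangle p" for i j
  proof (rule le_by_columns)
    fix k assume k: "k \<in> {1..m}" and "?t (i, j) \<le> k"
    then have "j \<le> cumulant p r (p + 2 - i - j) k"
      using branching_of_shape_le_iff[OF r ij k] by simp
    also have "\<dots> \<le> cumulant p r (p + 2 - (i + 1) - j) k"
    proof -
      have "p + 2 - (i + 1) - j \<le> p" "p + 2 - i - j = p + 2 - (i + 1) - j + 1"
        using ij ij' by (auto simp: triangle_def)
      then show ?thesis by (metis cumulant_unfold le_add2)
    qed
    finally show "?t (i + 1, j) \<le> k"
      using branching_of_shape_le_iff[OF r ij' k] by simp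
  qed (use bounds ij ij' in auto)
  moreover have "?t (i, j) \<le> ?t (i, j + 1)"
    if ij: "(i, j) \<in> triangle p" and ij': "(i, j + 1) \<in> triangle p" for i j
  proof (rule le_by_columns)
    fix k assume k: "k \<in> {1..m}" and "?t (i, j + 1) \<le> k"
    then have "j + 1 \<le> cumulant p r (p + 2 - i - (j + 1)) k"
      using branching_of_shape_le_iff[OF r ij' k] by simp
    moreover have "cumulant p r (p + 2 - i - (j + 1)) k \<le> 1 + cumulant p r (p + 2 - i - j) k"
    proof -
      have a: "p + 2 - i - (j + 1) \<in> {1..p}" "p + 2 - i - j = p + 2 - i - (j + 1) + 1"
        using ij ij' by (auto simp: triangle_def)
      then show ?thesis
        using cumulant_unfold[of "p + 2 - i - (j + 1)" p r k] gapless_entry_le_1[OF r a(1) k] by simp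
    qed
    ultimately show "?t (i, j) \<le> k"
      using branching_of_shape_le_iff[OF r ij k] by simp
  qed (use bounds ij ij' in auto)
  moreover have "?t \<in> triangle p \<rightarrow>\<^sub>E {1..}"
  proof (rule PiE_I)
    fix x assume "x \<in> triangle p"
    then show "?t x \<in> {1..}" using bounds by (cases x) auto
  next
    fix x assume "x \<notin> triangle p"
    then show "?t x = undefined" by (simp add: branching_of_shape_def)
  qed
  ultimately show ?thesis unfolding branchings_def by blast
qed

text \<open>
  The equivalence recovers each cumulant from the thresholds, because the values \<open>j \<le> p + 1 - a\<close>
  tested by the antidiagonal exhaust the range of row \<open>a\<close>. Differences of consecutive cumulants
  then recover the shape.
\<close>

lemma inj_on_branching_of_shape: "inj_on (branching_of_shape p m) (gapless_shapes p m)"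
proof (rule inj_onI)
  fix r r' assume r: "r \<in> gapless_shapes p m" and r': "r' \<in> gapless_shapes p m"
    and eq: "branching_of_shape p m r = branching_of_shape p m r'"
  have cumulants: "cumulant p r a k = cumulant p r' a k" if a: "a \<ge> 1" and k: "k \<in> {1..m}" for a k
  proof -
    have iff: "j \<le> cumulant p r a k \<longleftrightarrow> j \<le> cumulant p r' a k" if "j \<ge> 1" "j \<le> p + 1 - a" for j
    proof -
      have "a + j \<le> p + 1" using that by linarith
      then show ?thesis
        using branching_of_shape_antidiagonal_le_iff[OF r k a that(1)]
          branching_of_shape_antidiagonal_le_iff[OF r' k a that(1)] eq by simp
    qed
    have "cumulant p r a k \<le> p + 1 - a" "cumulant p r' a k \<le> p + 1 - a"
      using cumulant_le a k r r' by blast+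
    then show ?thesis
      using iff[of "cumulant p r a k"] iff[of "cumulant p r' a k"] by linarith
  qed
  have "r \<in> {1..p} \<times> {1..m} \<rightarrow>\<^sub>E {0, 1}" "r' \<in> {1..p} \<times> {1..m} \<rightarrow>\<^sub>E {0, 1}"
    using r r' by (auto simp: gapless_shapes_def)
  moreover have "r x = r' x" if "x \<in> {1..p} \<times> {1..m}" for x
  proof -
    obtain a k where x: "x = (a, k)" and a: "a \<in> {1..p}" and k: "k \<in> {1..m}"
      using \<open>x \<in> {1..p} \<times> {1..m}\<close> by blast
    show ?thesis
      using x cumulants[of a k] cumulants[of "a + 1" k] a k
        cumulant_unfold[of a p r k] cumulant_unfold[of a p r' k] by simp
  qed
  ultimately show "r = r'" by (rule PiE_ext)
qed

section \<open>The shape of a branching\<close>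

definition antidiagonal_count :: "nat \<Rightarrow> (nat \<times> nat \<Rightarrow> nat) \<Rightarrow> nat \<Rightarrow> nat \<Rightarrow> nat" where
  "antidiagonal_count p b a k = card {j \<in> {1..p + 1 - a}. b (p + 2 - a - j, j) \<le> k}"

definition shape_of_branching ::
  "nat \<Rightarrow> nat \<Rightarrow> (nat \<times> nat \<Rightarrow> nat) \<Rightarrow> nat \<times> nat \<Rightarrow> nat" where
  "shape_of_branching p m b =
    (\<lambda>(a, k) \<in> {1..p} \<times> {1..m}. antidiagonal_count p b a k - antidiagonal_count p b (a + 1) k)"

text \<open>
  The branching inequalities, read along antidiagonals: the antidiagonal of row \<open>a + 1\<close> lies between
  consecutive entries of that of row \<open>a\<close>.
\<close>

lemma branching_interlacing:
  assumes b: "b \<in> branchings p" and a: "a \<ge> 1" and j: "j \<ge> 1" and le: "a + 1 + j \<le> p + 1"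
  shows "b (p + 2 - a - j, j) \<le> b (p + 2 - (a + 1) - j, j)"
    and "b (p + 2 - (a + 1) - j, j) \<le> b (p + 2 - a - (j + 1), j + 1)"
proof -
  define i where "i = p + 2 - (a + 1) - j"
  have i: "p + 2 - a - j = i + 1" "p + 2 - a - (j + 1) = i"
    using le by (auto simp: i_def)
  have "(i, j) \<in> triangle p" "(i + 1, j) \<in> triangle p" "(i, j + 1) \<in> triangle p"
    using a j le by (auto simp: triangle_def i_def)
  then show "b (p + 2 - a - j, j) \<le> b (p + 2 - (a + 1) - j, j)"
    and "b (p + 2 - (a + 1) - j, j) \<le> b (p + 2 - a - (j + 1), j + 1)"
    using b i unfolding branchings_def i_def[symmetric] by auto
qed

text \<open>Two interlacing inequalities compose to a step along the antidiagonal.\<close>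

lemma branching_antidiagonal_mono:
  assumes b: "b \<in> branchings p" and a: "a \<ge> 1" and j: "j \<ge> 1" and "j \<le> l" "a + l \<le> p + 1"
  shows "b (p + 2 - a - j, j) \<le> b (p + 2 - a - l, l)"
  using assms(4,5)
proof (induction l rule: dec_induct)
  case base
  then show ?case by simp
next
  case (step l)
  have "b (p + 2 - a - l, l) \<le> b (p + 2 - a - (l + 1), l + 1)"
    using branching_interlacing[OF b a, of l] step j by simp
  then show ?case using step by simp
qed

lemma antidiagonal_count_le: "antidiagonal_count p b a k \<le> p + 1 - a"
proof -
  have "antidiagonal_count p b a k \<le> card {1..p + 1 - a}"
    unfolding antidiagonal_count_def by (rule card_mono) auto
  then show ?thesis by simp
qed

lemma le_card_initial_segment_iff:
  fixes n :: nat
  assumes down: "\<And>j l. 1 \<le> j \<Longrightarrow> j \<le> l \<Longrightarrow> l \<le> n \<Longrightarrow> P l \<Longrightarrow> P j"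
    and j: "j \<in> {1..n}"
  shows "j \<le> card {l \<in> {1..n}. P l} \<longleftrightarrow> P j"
proof
  assume "P j"
  then have "{1..j} \<subseteq> {l \<in> {1..n}. P l}"
    using down j by auto
  then have "card {1..j} \<le> card {l \<in> {1..n}. P l}" by (intro card_mono) auto
  then show "j \<le> card {l \<in> {1..n}. P l}" by simp
next
  assume le: "j \<le> card {l \<in> {1..n}. P l}"
  show "P j"
  proof (rule ccontr)
    assume "\<not> P j"
    have "l < j" if "l \<in> {1..n}" "P l" for l
      using down[of j l] that j \<open>\<not> P j\<close> by (cases "j \<le> l") auto
    then have "{l \<in> {1..n}. P l} \<subseteq> {1..<j}" by auto
    then have "card {l \<in> {1..n}. P l} \<le> card {1..<j}" by (intro card_mono) auto
    then show False using le j unfolding card_atLeastLessThan atLeastAtMost_iff by linarith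
  qed
qed

lemma le_antidiagonal_count_iff:
  assumes b: "b \<in> branchings p" and a: "a \<ge> 1" and j: "j \<ge> 1" and le: "a + j \<le> p + 1"
  shows "j \<le> antidiagonal_count p b a k \<longleftrightarrow> b (p + 2 - a - j, j) \<le> k"
  unfolding antidiagonal_count_def
proof (rule le_card_initial_segment_iff)
  fix i l assume "1 \<le> i" "i \<le> l" "l \<le> p + 1 - a" "b (p + 2 - a - l, l) \<le> k"
  then show "b (p + 2 - a - i, i) \<le> k"
    using branching_antidiagonal_mono[OF b a, of i l] j le by linarith
qed (use j le in auto)

lemma antidiagonal_count_Suc_le:
  assumes b: "b \<in> branchings p" and a: "a \<ge> 1"
  shows "antidiagonal_count p b (a + 1) k \<le> antidiagonal_count p b a k"
proof (cases "antidiagonal_count p b (a + 1) k")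
  case (Suc n)
  then have le: "a + 1 + Suc n \<le> p + 1"
    using antidiagonal_count_le[of p b "a + 1" k] by simp
  then have "b (p + 2 - (a + 1) - Suc n, Suc n) \<le> k"
    using le_antidiagonal_count_iff[OF b, of "a + 1" "Suc n" k] a Suc by simp
  then have "b (p + 2 - a - Suc n, Suc n) \<le> k"
    using branching_interlacing(1)[OF b a, of "Suc n"] le by simp
  then show ?thesis
    using le_antidiagonal_count_iff[OF b a, of "Suc n" k] le Suc by simp
qed simp

lemma antidiagonal_count_le_Suc:
  assumes b: "b \<in> branchings p" and a: "a \<ge> 1"
  shows "antidiagonal_count p b a k \<le> antidiagonal_count p b (a + 1) k + 1"
proof (cases "antidiagonal_count p b a k \<le> 1")
  case False
  \<comment> \<open>The last entry counted interlaces with position \<open>n\<close> of the next antidiagonal, and \<open>n \<ge> 1\<close>.\<close>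
  define n where "n = antidiagonal_count p b a k - 1"
  have n: "antidiagonal_count p b a k = n + 1" "n \<ge> 1"
    using False by (auto simp: n_def)
  have le: "a + 1 + n \<le> p + 1"
    using antidiagonal_count_le[of p b a k] n by simp
  then have "b (p + 2 - a - (n + 1), n + 1) \<le> k"
    using le_antidiagonal_count_iff[OF b a, of "n + 1" k] n by simp
  then have "b (p + 2 - (a + 1) - n, n) \<le> k"
    using branching_interlacing(2)[OF b a n(2) le] by simp
  then show ?thesis
    using le_antidiagonal_count_iff[OF b _ n(2) le, of k] n by simp
qed simp

text \<open>
  The sum of the differences telescopes to its first term, as the antidiagonal \<open>a = p + 1\<close> is empty.
\<close>

lemma cumulant_shape_of_branching:
  assumes b: "b \<in> branchings p" and k: "k \<in> {1..m}" and a: "a \<ge> 1" and "a \<le> p + 1"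
  shows "cumulant p (shape_of_branching p m b) a k = antidiagonal_count p b a k"
  using assms(4,3)
proof (induction a rule: inc_induct)
  case base
  then show ?case by (simp add: cumulant_def antidiagonal_count_def)
next
  case (step a)
  then have "cumulant p (shape_of_branching p m b) (a + 1) k = antidiagonal_count p b (a + 1) k"
    by simp
  then have "cumulant p (shape_of_branching p m b) a k
      = antidiagonal_count p b a k - antidiagonal_count p b (a + 1) k
        + antidiagonal_count p b (a + 1) k"
    using step k by (simp add: cumulant_unfold shape_of_branching_def)
  then show ?case using antidiagonal_count_Suc_le[OF b, of a k] step by simp
qed

lemma shape_of_branching_gapless:
  assumes b: "b \<in> branchings p"
  shows "shape_of_branching p m b \<in> gapless_shapes p m"
proof -
  have "shape_of_branching p m b \<in> {1..p} \<times> {1..m} \<rightarrow>\<^sub>E {0, 1}"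
  proof (rule PiE_I)
    fix x assume "x \<in> {1..p} \<times> {1..m}"
    then obtain a k where x: "x = (a, k)" and a: "a \<in> {1..p}" and k: "k \<in> {1..m}" by blast
    then show "shape_of_branching p m b x \<in> {0, 1}"
      using antidiagonal_count_le_Suc[OF b, of a k] by (auto simp: shape_of_branching_def)
  next
    fix x assume "x \<notin> {1..p} \<times> {1..m}"
    then show "shape_of_branching p m b x = undefined"
      by (simp only: shape_of_branching_def restrict_apply if_False)
  qed
  moreover have "cumulant p (shape_of_branching p m b) i j
      \<le> cumulant p (shape_of_branching p m b) i (j + 1)"
    if "1 \<le> i" "i \<le> p" "1 \<le> j" "j < m" for i j
  proof -
    have "antidiagonal_count p b i j \<le> antidiagonal_count p b i (j + 1)"
      unfolding antidiagonal_count_def by (rule card_mono) auto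
    then show ?thesis
      using that cumulant_shape_of_branching[OF b, of _ m i] by simp
  qed
  ultimately show ?thesis unfolding gapless_shapes_def cumulant_def by blast
qed

lemma branching_of_shape_of_branching:
  assumes b: "b \<in> branchings p" and bound: "\<forall>(i, j) \<in> triangle p. b (i, j) \<le> m + 1"
  shows "branching_of_shape p m (shape_of_branching p m b) = b"
proof (rule PiE_ext)
  let ?t = "branching_of_shape p m (shape_of_branching p m b)"
  have r: "shape_of_branching p m b \<in> gapless_shapes p m"
    using b by (rule shape_of_branching_gapless)
  then show "?t \<in> triangle p \<rightarrow>\<^sub>E {1..}"
    using branching_of_shape_in_branchings by (auto simp: branchings_def)
  show "b \<in> triangle p \<rightarrow>\<^sub>E {1..}" using b by (auto simp: branchings_def)
  fix x assume "x \<in> triangle p"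
  then obtain i j where x: "x = (i, j)" and ij: "(i, j) \<in> triangle p" by (cases x) auto
  define a where "a = p + 2 - i - j"
  have a: "a \<ge> 1" "j \<ge> 1" "a + j \<le> p + 1" "i = p + 2 - a - j"
    using ij by (auto simp: triangle_def a_def)
  have iff: "?t (i, j) \<le> k \<longleftrightarrow> b (i, j) \<le> k" if k: "k \<in> {1..m}" for k
    using branching_of_shape_antidiagonal_le_iff[OF r k a(1-3)]
      cumulant_shape_of_branching[OF b k, of a] le_antidiagonal_count_iff[OF b a(1-3), of k] a
    by simp
  have bounds: "?t (i, j) \<in> {1..m + 1}" "b (i, j) \<in> {1..m + 1}"
    using branching_of_shape_bounds[OF ij] b bound ij by (auto simp: branchings_def)
  have "?t (i, j) \<le> b (i, j)"
    by (rule le_by_columns[of _ m]) (use bounds iff in auto)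
  moreover have "b (i, j) \<le> ?t (i, j)"
    by (rule le_by_columns[of _ m]) (use bounds iff in auto)
  ultimately show "?t x = b x" using x by simp
qed

theorem proposition3:
  fixes p m :: nat
  assumes "p \<ge> 1" and "m \<ge> 1"
  shows "bij_betw (branching_of_shape p m)
           (gapless_shapes p m)
           {b \<in> branchings p. \<forall>(i, j) \<in> triangle p. b (i, j) \<le> m + 1}"
  unfolding bij_betw_def
proof (intro conjI equalityI subsetI)
  show "inj_on (branching_of_shape p m) (gapless_shapes p m)"
    by (rule inj_on_branching_of_shape)
next
  fix b assume "b \<in> branching_of_shape p m ` gapless_shapes p m"
  then show "b \<in> {b \<in> branchings p. \<forall>(i, j) \<in> triangle p. b (i, j) \<le> m + 1}"
    using branching_of_shape_in_branchings branching_of_shape_bounds by fastforce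
next
  fix b assume "b \<in> {b \<in> branchings p. \<forall>(i, j) \<in> triangle p. b (i, j) \<le> m + 1}"
  then have "b = branching_of_shape p m (shape_of_branching p m b)"
    and "shape_of_branching p m b \<in> gapless_shapes p m"
    using branching_of_shape_of_branching shape_of_branching_gapless by auto
  then show "b \<in> branching_of_shape p m ` gapless_shapes p m" by (rule image_eqI)
qed

end
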